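(* Let $L$ be a field of $\mathbb{C}$-linear endomorphisms of the tangent spaces of a complex manifold $(\mathsf M,J)$ of complex dimension $n$, given in complex coordinates $z_1,\dots,z_n$ by a complex matrix $L(z)=\bigl(L^i_j(z)\bigr)$ with smooth but not necessarily holomorphic entries. Let $L_{\mathbb{R}}$ denote $L$ viewed as a real operator on the $2n$-dimensional real manifold $\mathsf M$. (1) Assume that the complex Haantjes torsion of $L$ vanishes, i.e. for all $\alpha,\beta=1,\dots,n$ $$\mathcal H_L(\partial_{z_\alpha},\partial_{z_\beta})=L^2\mathcal N_L(\partial_{z_\alpha},\partial_{z_\beta})+\mathcal N_L(L\partial_{z_\alpha},L\partial_{z_\beta})-L\mathcal N_L(L\partial_{z_\alpha},\partial_{z_\beta})-L\mathcal N_L(\partial_{z_\alpha},L\partial_{z_\beta})=0,$$ and that the matrix $\frac{\partial L}{\partial\bar z_\alpha}$ commutes with $L$ for $\alpha=1,\dots,n$. Then $L_{\mathbb{R}}$ is a Haantjes operator in the real sense. (2) Conversely, if $L_{\mathbb{R}}$ is Haantjes in the real sense and each eigenvalue of (the complex matrix) $L$ has positive imaginary part, then $\frac{\partial L}{\partial\bar z_\alpha}$ commutes with $L$ for all $\alpha=1,\dots,n$, and $\mathcal H_L(\partial_{z_\alpha},\partial_{z_\beta})=0$ for all $\alpha,\beta$.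
   Context: For an operator $L$ the Nijenhuis torsion is $\mathcal N_L(\xi,\eta)=L^2[\xi,\eta]+[L\xi,L\eta]-L[L\xi,\eta]-L[\xi,L\eta]$ and the Haantjes torsion is $\mathcal H_L(\xi,\eta)=L^2\mathcal N_L(\xi,\eta)+\mathcal N_L(L\xi,L\eta)-L\,\mathcal N_L(L\xi,\eta)-L\,\mathcal N_L(\xi,L\eta)$. A real operator is Haantjes (in the real sense) if its Haantjes torsion vanishes on all real vector fields. In the complex Haantjes torsion, $L$ acts by $L\partial_{z_j}=\sum_i L^i_j\partial_{z_i}$ on vector fields that are combinations of $\partial_{z_1},\dots,\partial_{z_n}$ with smooth complex-valued coefficients, and the Lie bracket is the complex bilinear extension of the usual one, with $\partial_{z_\alpha}=\frac12(\partial_{x_\alpha}-\mathrm{i}\partial_{y_\alpha})$, $\partial_{\bar z_\alpha}=\frac12(\partial_{x_\alpha}+\mathrm{i}\partial_{y_\alpha})$, $z_\alpha=x_\alpha+\mathrm{i}y_\alpha$. $\frac{\partial L}{\partial\bar z_\alpha}$ is the matrix of entrywise derivatives. *)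

theory Defs
  imports "HOL-Analysis.Analysis"
begin

text \<open>
  A tangent space of a complex manifold is described in a complex coordinate system by
  \<open>complex^'n\<close>, which is used in two ways.
  \<^item> As the real tangent space of dimension \<open>2n\<close>: \<open>v\<close> stands for
    \<open>\<Sum>\<^sub>\<alpha> Re (v $ \<alpha>) \<partial>\<^sub>x\<^sub>\<alpha> + Im (v $ \<alpha>) \<partial>\<^sub>y\<^sub>\<alpha>\<close>, so that \<open>J\<close> is multiplication by \<open>\<i>\<close>.
  \<^item> As the space of complex vectors \<open>\<Sum>\<^sub>\<alpha> v $ \<alpha> \<partial>\<^sub>z\<^sub>\<alpha>\<close> of type \<open>(1,0)\<close>.

  In both descriptions the field of endomorphisms with complex matrix \<open>L z\<close> acts as
  \<open>v \<mapsto> L z *v v\<close>; they differ in the Lie bracket.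
\<close>

subsection \<open>Smooth maps\<close>

text \<open>These notions are meant for open \<open>S\<close>; \<open>'a\<close> will be finite-dimensional.\<close>

fun Ck_on :: "nat \<Rightarrow> 'a set \<Rightarrow> ('a::real_normed_vector \<Rightarrow> 'b::real_normed_vector) \<Rightarrow> bool" where
  "Ck_on 0 S f \<longleftrightarrow> continuous_on S f"
| "Ck_on (Suc k) S f \<longleftrightarrow>
     (\<forall>x\<in>S. f differentiable (at x)) \<and>
     (\<forall>v. Ck_on k S (\<lambda>x. frechet_derivative f (at x) v))"

definition smooth_on :: "'a set \<Rightarrow> ('a::real_normed_vector \<Rightarrow> 'b::real_normed_vector) \<Rightarrow> bool" where
  "smooth_on S f \<longleftrightarrow> (\<forall>k. Ck_on k S f)"

text \<open>Holomorphic maps of several variables: smooth maps whose differential commutes with \<open>J\<close>.\<close>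

definition holo_map_on :: "(complex^'n) set \<Rightarrow> (complex^'n \<Rightarrow> complex^'m) \<Rightarrow> bool" where
  "holo_map_on S f \<longleftrightarrow> smooth_on S f \<and>
     (\<forall>z\<in>S. \<forall>v. frechet_derivative f (at z) (\<i> *s v) = \<i> *s frechet_derivative f (at z) v)"

subsection \<open>Torsions\<close>

text \<open>
  The torsions of an operator \<open>T\<close> on vector fields, for vector fields given by their coefficients
  in a coordinate system and a Lie bracket \<open>br\<close> on them.
\<close>

type_synonym 'v vfield = "'v \<Rightarrow> 'v"

definition nijenhuis ::
  "(('v::real_vector) vfield \<Rightarrow> 'v vfield \<Rightarrow> 'v vfield) \<Rightarrow> ('v vfield \<Rightarrow> 'v vfield) \<Rightarrow>
   'v vfield \<Rightarrow> 'v vfield \<Rightarrow> 'v vfield" where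
  "nijenhuis br T X Y =
     (\<lambda>z. T (T (br X Y)) z + br (T X) (T Y) z - T (br (T X) Y) z - T (br X (T Y)) z)"

definition haantjes ::
  "(('v::real_vector) vfield \<Rightarrow> 'v vfield \<Rightarrow> 'v vfield) \<Rightarrow> ('v vfield \<Rightarrow> 'v vfield) \<Rightarrow>
   'v vfield \<Rightarrow> 'v vfield \<Rightarrow> 'v vfield" where
  "haantjes br T X Y =
     (\<lambda>z. T (T (nijenhuis br T X Y)) z + nijenhuis br T (T X) (T Y) z
          - T (nijenhuis br T (T X) Y) z - T (nijenhuis br T X (T Y)) z)"

definition matrix_action :: "(complex^'n \<Rightarrow> complex^'n^'n) \<Rightarrow> (complex^'n) vfield \<Rightarrow> (complex^'n) vfield" where
  "matrix_action L X = (\<lambda>z. L z *v X z)"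

text \<open>The Lie bracket of real vector fields.\<close>

definition real_lie :: "('v::real_normed_vector) vfield \<Rightarrow> 'v vfield \<Rightarrow> 'v vfield" where
  "real_lie X Y = (\<lambda>z. frechet_derivative Y (at z) (X z) - frechet_derivative X (at z) (Y z))"

definition d_x :: "'n \<Rightarrow> (complex^'n \<Rightarrow> complex) \<Rightarrow> complex^'n \<Rightarrow> complex" where
  "d_x \<alpha> f z = frechet_derivative f (at z) (axis \<alpha> 1)"

definition d_y :: "'n \<Rightarrow> (complex^'n \<Rightarrow> complex) \<Rightarrow> complex^'n \<Rightarrow> complex" where
  "d_y \<alpha> f z = frechet_derivative f (at z) (axis \<alpha> \<i>)"

definition d_z :: "'n \<Rightarrow> (complex^'n \<Rightarrow> complex) \<Rightarrow> complex^'n \<Rightarrow> complex" where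
  "d_z \<alpha> f z = (d_x \<alpha> f z - \<i> * d_y \<alpha> f z) / 2"

definition d_zbar :: "'n \<Rightarrow> (complex^'n \<Rightarrow> complex) \<Rightarrow> complex^'n \<Rightarrow> complex" where
  "d_zbar \<alpha> f z = (d_x \<alpha> f z + \<i> * d_y \<alpha> f z) / 2"

definition d_zbar_matrix ::
  "'n \<Rightarrow> (complex^'n \<Rightarrow> complex^'n^'n) \<Rightarrow> complex^'n \<Rightarrow> complex^'n^'n" where
  "d_zbar_matrix \<alpha> L z = (\<chi> i j. d_zbar \<alpha> (\<lambda>w. L w $ i $ j) z)"

text \<open>
  The complex bilinear extension of the Lie bracket, on fields \<open>\<Sum>\<^sub>j X\<^sub>j \<partial>\<^sub>z\<^sub>j\<close> with smooth complex
  coefficients: as the \<open>\<partial>\<^sub>z\<^sub>j\<close> commute, only the terms with derivatives of the coefficients remain.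
\<close>

definition complex_lie :: "(complex^'n) vfield \<Rightarrow> (complex^'n) vfield \<Rightarrow> (complex^'n) vfield" where
  "complex_lie X Y = (\<lambda>z. \<chi> k. \<Sum>j\<in>UNIV.
     X z $ j * d_z j (\<lambda>w. Y w $ k) z - Y z $ j * d_z j (\<lambda>w. X w $ k) z)"

text \<open>The coordinate field \<open>\<partial>\<^sub>z\<^sub>\<alpha>\<close>.\<close>

definition coord_field :: "'n \<Rightarrow> (complex^'n) vfield" where
  "coord_field \<alpha> = (\<lambda>z. axis \<alpha> 1)"

subsection \<open>Complex manifolds\<close>

text \<open>A chart is a domain together with a coordinate map, whose values off the domain are irrelevant.\<close>

type_synonym ('m, 'n) chart = "'m set \<times> ('m \<Rightarrow> complex^'n)"

definition chart_image :: "('m, 'n) chart \<Rightarrow> (complex^'n) set" where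
  "chart_image c = snd c ` fst c"

text \<open>
  The coordinate change from \<open>c\<close> to \<open>d\<close>, defined on the part \<open>overlap c d\<close> of the image of \<open>c\<close>.
\<close>

definition overlap :: "('m, 'n) chart \<Rightarrow> ('m, 'n) chart \<Rightarrow> (complex^'n) set" where
  "overlap c d = snd c ` (fst c \<inter> fst d)"

definition transition :: "('m, 'n) chart \<Rightarrow> ('m, 'n) chart \<Rightarrow> complex^'n \<Rightarrow> complex^'n" where
  "transition c d = snd d \<circ> inv_into (fst c) (snd c)"

abbreviation d_transition ::
  "('m, 'n) chart \<Rightarrow> ('m, 'n) chart \<Rightarrow> complex^'n \<Rightarrow> complex^'n \<Rightarrow> complex^'n" where
  "d_transition c d z \<equiv> frechet_derivative (transition c d) (at z)"

text \<open>The atlas \<open>A\<close> need not be maximal.\<close>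

definition complex_manifold :: "'m topology \<Rightarrow> ('m, 'n::finite) chart set \<Rightarrow> bool" where
  "complex_manifold M A \<longleftrightarrow>
     Hausdorff_space M \<and> second_countable M \<and>
     (\<Union>c\<in>A. fst c) = topspace M \<and>
     (\<forall>c\<in>A. openin M (fst c) \<and> open (chart_image c) \<and>
        homeomorphic_map (subtopology M (fst c)) (top_of_set (chart_image c)) (snd c)) \<and>
     (\<forall>c\<in>A. \<forall>d\<in>A. holo_map_on (overlap c d) (transition c d))"

text \<open>
  Tensor fields on the manifold are families of their coordinate expressions in the charts, as
  functions of the coordinates, subject to the transformation law.
\<close>

definition endomorphism_field ::
  "('m, 'n::finite) chart set \<Rightarrow> (('m, 'n) chart \<Rightarrow> complex^'n \<Rightarrow> complex^'n^'n) \<Rightarrow> bool" where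
  "endomorphism_field A L \<longleftrightarrow>
     (\<forall>c\<in>A. smooth_on (chart_image c) (L c)) \<and>
     (\<forall>c\<in>A. \<forall>d\<in>A. \<forall>z\<in>overlap c d. \<forall>v.
        d_transition c d z (L c z *v v) = L d (transition c d z) *v d_transition c d z v)"

definition real_vector_field ::
  "('m, 'n::finite) chart set \<Rightarrow> (('m, 'n) chart \<Rightarrow> (complex^'n) vfield) \<Rightarrow> bool" where
  "real_vector_field A X \<longleftrightarrow>
     (\<forall>c\<in>A. smooth_on (chart_image c) (X c)) \<and>
     (\<forall>c\<in>A. \<forall>d\<in>A. \<forall>z\<in>overlap c d.
        d_transition c d z (X c z) = X d (transition c d z))"

text \<open>The operator \<open>L\<^sub>\<real>\<close> is Haantjes in the real sense.\<close>

definition real_haantjes ::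
  "('m, 'n::finite) chart set \<Rightarrow> (('m, 'n) chart \<Rightarrow> complex^'n \<Rightarrow> complex^'n^'n) \<Rightarrow> bool" where
  "real_haantjes A L \<longleftrightarrow>
     (\<forall>X Y. real_vector_field A X \<longrightarrow> real_vector_field A Y \<longrightarrow>
        (\<forall>c\<in>A. \<forall>z\<in>chart_image c. haantjes real_lie (matrix_action (L c)) (X c) (Y c) z = 0))"

text \<open>The complex Haantjes torsion vanishes, in each complex coordinate system of the atlas.\<close>

definition complex_haantjes ::
  "('m, 'n::finite) chart set \<Rightarrow> (('m, 'n) chart \<Rightarrow> complex^'n \<Rightarrow> complex^'n^'n) \<Rightarrow> bool" where
  "complex_haantjes A L \<longleftrightarrow>
     (\<forall>c\<in>A. \<forall>z\<in>chart_image c. \<forall>\<alpha> \<beta>.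
        haantjes complex_lie (matrix_action (L c)) (coord_field \<alpha>) (coord_field \<beta>) z = 0)"

definition commutes_with_d_zbar ::
  "('m, 'n::finite) chart set \<Rightarrow> (('m, 'n) chart \<Rightarrow> complex^'n \<Rightarrow> complex^'n^'n) \<Rightarrow> bool" where
  "commutes_with_d_zbar A L \<longleftrightarrow>
     (\<forall>c\<in>A. \<forall>z\<in>chart_image c. \<forall>\<alpha>.
        d_zbar_matrix \<alpha> (L c) z ** L c z = L c z ** d_zbar_matrix \<alpha> (L c) z)"

definition is_eigenvalue :: "complex^'n^'n \<Rightarrow> complex \<Rightarrow> bool" where
  "is_eigenvalue B \<mu> \<longleftrightarrow> (\<exists>v. v \<noteq> 0 \<and> B *v v = \<mu> *s v)"

end

theory Submission
  imports Defs "HOL-Computational_Algebra.Fundamental_Theorem_Algebra"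
begin

text \<open>
  Write \<open>D u\<close> for the derivative of \<open>L\<close> along \<open>u\<close>. The Haantjes torsion at a point is an algebraic
  expression in \<open>L\<close> and \<open>D\<close>, and the complex torsion is the same expression in the complex linear
  part \<open>D'\<close> of \<open>D\<close>. The contribution of the antilinear part \<open>D''\<close> is \<open>P u v - P v u\<close> with \<open>P\<close>
  antilinear in the first and linear in the second argument, and it vanishes when \<open>D''\<close> commutes
  with \<open>L\<close>.

  Conversely, comparing the real torsion at \<open>(u, v)\<close> and \<open>(u, \<i> v)\<close> shows that the complex torsion and
  \<open>P\<close> vanish separately. For \<open>E u = [L, D'' u]\<close>, the equation \<open>P = 0\<close> reads
  \<open>E (L\<^sup>2 u) - 2 L E (L u) + L\<^sup>2 E u = 0\<close>. As \<open>E\<close> is antilinear and no eigenvalue of \<open>L\<close> is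
  the conjugate of an eigenvalue, the Sylvester operator \<open>E \<mapsto> E \<circ> L - L \<circ> E\<close> is injective, so \<open>E = 0\<close>.
\<close>

subsection \<open>Antilinear intertwiners of a complex matrix\<close>

text \<open>Horner scheme for the vector p(B) v. It acts on vectors because \<open>*\<close> on the
  matrix type is the entrywise product, so evaluating a polynomial at \<open>B\<close> itself would
  not give p(B).\<close>

definition poly_act :: "complex^'n^'n \<Rightarrow> complex poly \<Rightarrow> complex^'n \<Rightarrow> complex^'n::finite" where
  "poly_act B p v = fold_coeffs (\<lambda>a w. a *s v + B *v w) p 0"

lemma poly_act_0 [simp]: "poly_act B 0 v = 0"
  by (simp add: poly_act_def)

lemma poly_act_pCons [simp]: "poly_act B (pCons a p) v = a *s v + B *v poly_act B p v"
  by (cases "a = 0 \<and> p = 0") (auto simp: poly_act_def)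

lemma poly_act_add: "poly_act B (p + q) v = poly_act B p v + poly_act B q v"
  by (induction p q rule: poly_induct2)
     (simp_all add: matrix_vector_right_distrib vector_sadd_rdistrib)

lemma poly_act_smult: "poly_act B (smult c p) v = c *s poly_act B p v"
  by (induction p) (simp_all add: vector_scalar_commute vector_add_ldistrib vector_smult_assoc)

lemma poly_act_diff: "poly_act B (p - q) v = poly_act B p v - poly_act B q v"
  using poly_act_add[of B p "smult (- 1) q" v] poly_act_smult[of B "- 1" q v] by simp

lemma poly_act_monom: "poly_act B (monom c k) v = c *s (((*v) B) ^^ k) v"
  by (induction k) (simp_all add: monom_0 monom_Suc vector_scalar_commute)

lemma poly_act_sum: "poly_act B (\<Sum>i\<in>I. p i) v = (\<Sum>i\<in>I. poly_act B (p i) v)"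
  by (induction I rule: infinite_finite_induct) (simp_all add: poly_act_add)

lemma poly_act_linear_factor:
  "poly_act B ([:- a, 1:] * q) v = B *v poly_act B q v - a *s poly_act B q v"
  by (simp add: poly_act_diff poly_act_smult)

text \<open>p(B) commutes with B - a. Together with \<open>poly_act_linear_factor\<close> this lets
  a linear factor act either on the value or on the argument.\<close>

lemma poly_act_commute:
  "poly_act B p (B *v v - a *s v) = B *v poly_act B p v - a *s poly_act B p v"
  by (induction p) (simp_all add: matrix_vector_right_distrib matrix_vector_mult_diff_distrib
     vector_scalar_commute vector_add_ldistrib vec.scale_right_diff_distrib vector_smult_assoc
     mult.commute)

text \<open>The powers of \<open>B\<close> lie in a finite-dimensional real vector space, so they
  satisfy a nontrivial linear relation.\<close>

lemma annihilating_polynomial: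
  fixes B :: "complex^'n^'n::finite"
  obtains p where "p \<noteq> 0" "\<And>v. poly_act B p v = 0"
proof -
  define M where "M k = (((**) B) ^^ k) (mat 1)" for k
  have M: "M k *v v = (((*v) B) ^^ k) v" for k v
    unfolding M_def
    by (induction k) (simp_all add: matrix_vector_mul_assoc[symmetric])
  have "\<exists>p. p \<noteq> 0 \<and> (\<forall>v. poly_act B p v = 0)"
  \<comment> \<open>If two powers coincide, their difference is the relation, which linear
    dependence of the set \<open>range M\<close> would not see. Otherwise \<open>range M\<close> is
    infinite and hence dependent.\<close>
  proof (cases "inj M")
    case False
    then obtain i j where "i \<noteq> j" "M i = M j"
      by (auto simp: inj_def)
    then have "monom 1 i - monom 1 j \<noteq> (0 :: complex poly)"
      by (metis coeff_monom eq_iff_diff_eq_0 zero_neq_one)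
    moreover have "poly_act B (monom 1 i - monom 1 j) v = 0" for v
      using \<open>M i = M j\<close> M[of i v] M[of j v] by (simp add: poly_act_diff poly_act_monom)
    ultimately show ?thesis by blast
  next
    case True
    then have "dependent (range M)"
      using finiteI_independent finite_imageD by blast
    then obtain t c w where t: "finite t" "t \<subseteq> range M" "(\<Sum>X\<in>t. c X *\<^sub>R X) = 0"
        and w: "w \<in> t" "c w \<noteq> 0"
      unfolding real_vector.dependent_explicit by blast
    obtain I where I: "t = M ` I"
      using t(2) by (meson subset_image_iff)
    have fin: "finite I"
      using t(1) I True by (metis finite_imageD inj_on_subset subset_UNIV)
    \<comment> \<open>Injectivity of \<open>M\<close> identifies the matrices in \<open>t\<close>
      with exponents, so the relation becomes a polynomial whose coefficient at the exponent of
      \<open>w\<close> is nonzero.\<close>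
    define p where "p = (\<Sum>i\<in>I. monom (complex_of_real (c (M i))) i)"
    obtain k where k: "k \<in> I" "w = M k" using w I by blast
    have "coeff p k = complex_of_real (c w)"
      using fin k by (simp add: p_def coeff_sum)
    then have "p \<noteq> 0" using w by auto
    moreover have "poly_act B p v = 0" for v
    proof -
      have "poly_act B p v = (\<Sum>i\<in>I. complex_of_real (c (M i)) *s (M i *v v))"
        by (simp add: p_def poly_act_sum poly_act_monom M)
      also have "\<dots> = (\<Sum>i\<in>I. (c (M i) *\<^sub>R M i) *v v)"
        by (intro sum.cong refl)
           (auto simp: vec_eq_iff matrix_vector_mult_def sum_distrib_left scaleR_conv_of_real[where 'a=complex] mult.assoc)
      also have "\<dots> = (\<Sum>i\<in>I. c (M i) *\<^sub>R M i) *v v"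
        using fin by (induction I rule: finite_induct) (simp_all add: matrix_vector_mult_add_rdistrib)
      also have "(\<Sum>i\<in>I. c (M i) *\<^sub>R M i) = 0"
        using t(3) True by (simp add: I sum.reindex inj_on_def)
      finally show ?thesis by simp
    qed
    ultimately show ?thesis by blast
  qed
  then show ?thesis using that by blast
qed

text \<open>A nonzero kernel vector of B - \<mu> would be an eigenvector, and an injective real
  linear endomorphism in finite dimension is onto.\<close>

lemma surj_if_not_eigenvalue:
  fixes B :: "complex^'n^'n::finite"
  assumes "\<not> is_eigenvalue B \<mu>"
  shows "surj (\<lambda>v. B *v v - \<mu> *s v)"
proof (rule linear_injective_imp_surjective)
  show lin: "linear (\<lambda>v. B *v v - \<mu> *s v)"
    by (rule linearI) (auto simp: matrix_vector_right_distrib vec_eq_iff matrix_vector_mult_def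
       scaleR_sum_right sum.distrib algebra_simps)
  have "v = 0" if "B *v v - \<mu> *s v = 0" for v
    using assms that unfolding is_eigenvalue_def by auto
  then show "inj (\<lambda>v. B *v v - \<mu> *s v)"
    using linear_injective_0[OF lin] by blast
qed auto

text \<open>An antilinear intertwiner carries eigenvectors for \<mu> to eigenvectors for
  \<open>cnj \<mu>\<close> or to 0, and the spectrum is disjoint from its conjugate. As
  \<open>B\<close> may fail to be diagonalizable, the proof removes the linear factors of an
  annihilating polynomial one at a time under \<open>G\<close>.\<close>

lemma antilinear_intertwiner_eq_0:
  fixes B :: "complex^'n^'n::finite" and G :: "complex^'n \<Rightarrow> complex^'n"
  assumes diff: "\<And>u v. G (u - v) = G u - G v"
    and cnj: "\<And>a u. G (a *s u) = cnj a *s G u"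
    and inter: "\<And>u. G (B *v u) = B *v G u"
    and eig: "\<And>\<mu>. is_eigenvalue B \<mu> \<Longrightarrow> Im \<mu> > 0"
  shows "G u = 0"
proof -
  \<comment> \<open>Induction on the degree of a polynomial whose values are annihilated by
    \<open>G\<close>; once only a nonzero constant is left, it can be cancelled.\<close>
  have *: "G w = 0" if "degree p = k" "p \<noteq> 0" "\<And>v. G (poly_act B p v) = 0" for k p w
    using that
  proof (induction k arbitrary: p w)
    case 0
    then obtain a where "p = [:a:]" "a \<noteq> 0"
      by (metis degree_eq_zeroE pCons_0_0)
    then show ?case
      using 0(3)[of w] cnj by simp
  next
    case (Suc k)
    then obtain a where "poly p a = 0"
      using fundamental_theorem_of_algebra[of p] by (metis constant_degree nat.distinct(1))
    then obtain q where q: "p = [:- a, 1:] * q"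
      by (metis dvdE poly_eq_0_iff_dvd)
    then have "q \<noteq> 0" using Suc.prems by auto
    then have "degree q = k"
      using Suc.prems by (simp add: q degree_mult_eq del: mult_pCons_left)
    have G0: "G (B *v poly_act B q v - a *s poly_act B q v) = 0" for v
      using Suc.prems(3)[of v] by (simp only: q poly_act_linear_factor)
    have "G (poly_act B q v) = 0" for v
    \<comment> \<open>If \<open>a\<close> is an eigenvalue, a nonzero value of \<open>G\<close> here
      would be an eigenvector for \<open>cnj a\<close>, which lies in the lower half-plane. If not,
      B - a is onto, so \<open>v\<close> can be written as a value of it and the linear factor is
      restored.\<close>
    proof (cases "is_eigenvalue B a")
      case True
      then have "\<not> is_eigenvalue B (cnj a)"
        using eig[of a] eig[of "cnj a"] True by auto
      moreover have "B *v G (poly_act B q v) = cnj a *s G (poly_act B q v)"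
        using G0[of v] by (simp add: diff cnj inter)
      ultimately show ?thesis
        unfolding is_eigenvalue_def by blast
    next
      case False
      then obtain v' where "v = B *v v' - a *s v'"
        using surj_if_not_eigenvalue[OF False] by (meson surj_def)
      then show ?thesis
        using G0[of v'] by (simp add: poly_act_commute)
    qed
    with Suc.IH \<open>degree q = k\<close> \<open>q \<noteq> 0\<close> show ?case by blast
  qed
  obtain p where "p \<noteq> 0" "\<And>v. poly_act B p v = 0"
    using annihilating_polynomial by blast
  moreover have "G 0 = 0" using diff[of 0 0] by simp
  ultimately show ?thesis using *[of p] by auto
qed

text \<open>The quadratic relation is the Sylvester operator applied twice to \<open>E\<close>. It
  says that \<open>G\<close>, the first application, is an intertwiner, so \<open>G\<close>
  vanishes; then \<open>E\<close> itself is an intertwiner.\<close>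

lemma antilinear_double_intertwiner_eq_0:
  fixes B :: "complex^'n^'n::finite" and E :: "complex^'n \<Rightarrow> complex^'n"
  assumes diff: "\<And>u v. E (u - v) = E u - E v"
    and cnj: "\<And>a u. E (a *s u) = cnj a *s E u"
    and inter: "\<And>u. E (B *v (B *v u)) - 2 *s (B *v E (B *v u)) + B *v (B *v E u) = 0"
    and eig: "\<And>\<mu>. is_eigenvalue B \<mu> \<Longrightarrow> Im \<mu> > 0"
  shows "E u = 0"
proof -
  define G where "G u = E (B *v u) - B *v E u" for u
  have "G u = 0" for u
  proof (rule antilinear_intertwiner_eq_0[where B = B and G = G])
    show "G (u - v) = G u - G v" for u v
      by (simp add: G_def diff matrix_vector_mult_diff_distrib)
    show "G (a *s u) = cnj a *s G u" for a u
      by (simp add: G_def cnj vector_scalar_commute vec.scale_right_diff_distrib)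
    show "G (B *v u) = B *v G u" for u
      using inter[of u] by (simp add: G_def matrix_vector_mult_diff_distrib vec_eq_iff algebra_simps)
  qed (use eig in auto)
  then have "E (B *v u) = B *v E u" for u
    by (simp add: G_def)
  then show ?thesis
    using antilinear_intertwiner_eq_0[of E B] diff cnj eig by blast
qed

section \<open>Torsions as algebraic expressions in an operator and its derivative\<close>

definition nijenhuis_form ::
  "('v::real_vector \<Rightarrow> 'v) \<Rightarrow> ('v \<Rightarrow> 'v \<Rightarrow> 'v) \<Rightarrow> 'v \<Rightarrow> 'v \<Rightarrow> 'v" where
  "nijenhuis_form T D u v = D (T u) v - D (T v) u + T (D v u) - T (D u v)"

definition haantjes_form ::
  "('v::real_vector \<Rightarrow> 'v) \<Rightarrow> ('v \<Rightarrow> 'v \<Rightarrow> 'v) \<Rightarrow> 'v \<Rightarrow> 'v \<Rightarrow> 'v" where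
  "haantjes_form T D u v =
     T (T (nijenhuis_form T D u v)) + nijenhuis_form T D (T u) (T v)
     - T (nijenhuis_form T D (T u) v) - T (nijenhuis_form T D u (T v))"

text \<open>Collects the terms of \<open>haantjes_form\<close> in which the direction of
  differentiation comes from \<open>u\<close>; the other terms follow by exchanging the arguments.
  In terms of the commutators E u = [T, D u] it is -E(T^2 u) + 2 T E(T u) - T^2 E(u), applied to
  \<open>v\<close>.\<close>

definition haantjes_half ::
  "('v::real_vector \<Rightarrow> 'v) \<Rightarrow> ('v \<Rightarrow> 'v \<Rightarrow> 'v) \<Rightarrow> 'v \<Rightarrow> 'v \<Rightarrow> 'v" where
  "haantjes_half T D u v =
     T (T (D (T u) v - T (D u v))) + (D (T (T u)) (T v) - T (D (T u) (T v)))
     - T (D (T (T u)) v - T (D (T u) v)) - T (D (T u) (T v) - T (D u (T v)))"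

lemma haantjes_form_half:
  assumes "linear T"
  shows "haantjes_form T D u v = haantjes_half T D u v - haantjes_half T D v u"
  unfolding haantjes_form_def haantjes_half_def nijenhuis_form_def
  by (simp add: linear_diff[OF assms] linear_add[OF assms])

lemma haantjes_form_add:
  assumes "linear T"
  shows "haantjes_form T (\<lambda>u v. D u v + E u v) x y = haantjes_form T D x y + haantjes_form T E x y"
  unfolding haantjes_form_def nijenhuis_form_def
  by (simp add: linear_diff[OF assms] linear_add[OF assms])

text \<open>\<open>D\<close> enters the half only through the commutators of \<open>T\<close> with
  the maps \<open>D u\<close>.\<close>

lemma haantjes_half_eq_0:
  assumes "linear T" and "\<And>u v. D u (T v) = T (D u v)"
  shows "haantjes_half T D u v = 0"
  unfolding haantjes_half_def
  by (simp add: linear_diff[OF assms(1)] linear_add[OF assms(1)] assms(2))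

subsection \<open>Pointwise torsions\<close>

text \<open>The derivation \<open>\<delta>\<close> is left abstract to serve both brackets: it is
  the full derivative for the real one and its complex linear part for the complex one. By the
  product rule the derivatives of \<open>X\<close> and \<open>Y\<close> cancel, and only the
  derivative \<open>D\<close> of the operator remains.\<close>

lemma nijenhuis_pointwise:
  fixes T :: "('v::real_normed_vector) vfield \<Rightarrow> 'v vfield"
  assumes br: "\<And>X Y. X differentiable (at z) \<Longrightarrow> Y differentiable (at z) \<Longrightarrow>
      br X Y z = \<delta> Y (X z) - \<delta> X (Y z)"
    and prod: "\<And>X u. X differentiable (at z) \<Longrightarrow> \<delta> (T X) u = D u (X z) + B (\<delta> X u)"
    and T: "\<And>X. X differentiable (at z) \<Longrightarrow> T X differentiable (at z)" "\<And>X. T X z = B (X z)"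
    and B: "linear B"
    and XY: "X differentiable (at z)" "Y differentiable (at z)"
  shows "nijenhuis br T X Y z = nijenhuis_form B D (X z) (Y z)"
  unfolding nijenhuis_def nijenhuis_form_def
  by (simp add: br prod T XY linear_diff[OF B] linear_add[OF B])

text \<open>The Nijenhuis torsion is never differentiated in the Haantjes torsion, so its values at
  \<open>z\<close> on the fields and their images under \<open>T\<close> are enough.\<close>

lemma haantjes_pointwise:
  fixes T :: "('v::real_normed_vector) vfield \<Rightarrow> 'v vfield"
  assumes br: "\<And>X Y. X differentiable (at z) \<Longrightarrow> Y differentiable (at z) \<Longrightarrow>
      br X Y z = \<delta> Y (X z) - \<delta> X (Y z)"
    and prod: "\<And>X u. X differentiable (at z) \<Longrightarrow> \<delta> (T X) u = D u (X z) + B (\<delta> X u)"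
    and T: "\<And>X. X differentiable (at z) \<Longrightarrow> T X differentiable (at z)" "\<And>X. T X z = B (X z)"
    and B: "linear B"
    and XY: "X differentiable (at z)" "Y differentiable (at z)"
  shows "haantjes br T X Y z = haantjes_form B D (X z) (Y z)"
  unfolding haantjes_def haantjes_form_def
  by (simp add: nijenhuis_pointwise[where br = br and T = T and z = z and \<delta> = \<delta> and D = D and B = B, OF br prod T B] T XY)

lemma linear_matrix_vector_mult_complex: "linear ((*v) (B :: complex^'n^'m::finite))"
  by (rule linearI) (auto simp: matrix_vector_right_distrib vec_eq_iff matrix_vector_mult_def
      scaleR_sum_right sum.distrib distrib_left distrib_right)

lemma bounded_bilinear_matrix_vector_mult_complex:
  "bounded_bilinear ((*v) :: complex^'n^'m::finite \<Rightarrow> complex^'n::finite \<Rightarrow> complex^'m)"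
proof -
  have "linear (\<lambda>B :: complex^'n^'m. B *v v)" for v
    by (rule linearI) (auto simp: matrix_vector_mult_add_rdistrib vec_eq_iff matrix_vector_mult_def
      scaleR_sum_right sum.distrib distrib_left distrib_right)
  then show ?thesis
    by (simp add: bilinear_conv_bounded_bilinear[symmetric] bilinear_def
        linear_matrix_vector_mult_complex)
qed

lemma linear_matrix_vector_mult_left:
  fixes f :: "complex^'n::finite \<Rightarrow> complex^'n^'n::finite"
  assumes "linear f"
  shows "linear (\<lambda>u. f u *v v)"
  using linear_compose[OF assms] bounded_linear.linear[OF
      bounded_bilinear.bounded_linear_left[OF bounded_bilinear_matrix_vector_mult_complex]]
  by (fastforce simp: o_def)

lemma has_derivative_matrix_action:
  fixes L :: "complex^'n \<Rightarrow> complex^'n^'n::finite"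
  assumes "L differentiable (at z)" "X differentiable (at z)"
  shows "(matrix_action L X has_derivative
    (\<lambda>u. frechet_derivative L (at z) u *v X z + L z *v frechet_derivative X (at z) u)) (at z)"
  using bounded_bilinear.FDERIV[OF bounded_bilinear_matrix_vector_mult_complex
      assms[unfolded frechet_derivative_works]]
  by (simp add: matrix_action_def add.commute)

lemma differentiable_matrix_action:
  fixes L :: "complex^'n \<Rightarrow> complex^'n^'n::finite"
  assumes "L differentiable (at z)" "X differentiable (at z)"
  shows "matrix_action L X differentiable (at z)"
  using has_derivative_matrix_action[OF assms] differentiableI by blast

lemma frechet_derivative_matrix_action:
  fixes L :: "complex^'n \<Rightarrow> complex^'n^'n::finite"
  assumes "L differentiable (at z)" "X differentiable (at z)"
  shows "frechet_derivative (matrix_action L X) (at z) u =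
    frechet_derivative L (at z) u *v X z + L z *v frechet_derivative X (at z) u"
  by (rule fun_cong[OF frechet_derivative_at[OF has_derivative_matrix_action[OF assms]], symmetric])

section \<open>Complex linear and antilinear parts of real linear maps\<close>

definition lin_part :: "(complex^'n \<Rightarrow> complex^'m) \<Rightarrow> complex^'n \<Rightarrow> complex^'m" where
  "lin_part f u = (1 / 2) *s (f u - \<i> *s f (\<i> *s u))"

definition antilin_part :: "(complex^'n \<Rightarrow> complex^'m) \<Rightarrow> complex^'n \<Rightarrow> complex^'m" where
  "antilin_part f u = (1 / 2) *s (f u + \<i> *s f (\<i> *s u))"

lemma lin_part_add_antilin_part: "lin_part f u + antilin_part f u = f u"
  by (simp add: lin_part_def antilin_part_def vec_eq_iff algebra_simps)

lemma scaleR_conv_vector_smult: "r *\<^sub>R (v :: complex^'n) = complex_of_real r *s v"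
  by (simp add: vec_eq_iff scaleR_conv_of_real[where 'a = complex])

text \<open>Reduces complex multiples of \<open>u\<close> to the two vectors u and \<i> u, on which
  real linearity can act. The homogeneity of both parts then becomes a computation with two values
  of \<open>f\<close>.\<close>

lemma linear_vector_smult_split:
  fixes f :: "complex^'n \<Rightarrow> complex^'m"
  assumes "linear f"
  shows "f (a *s u) = complex_of_real (Re a) *s f u + complex_of_real (Im a) *s f (\<i> *s u)"
proof -
  have "a *s u = Re a *\<^sub>R u + Im a *\<^sub>R (\<i> *s u)"
    by (subst complex_eq[of a]) (simp add: scaleR_conv_vector_smult vector_sadd_rdistrib vector_smult_assoc mult.commute)
  then show ?thesis
    by (simp add: linear_add[OF assms] linear_cmul[OF assms]) (simp add: scaleR_conv_vector_smult)
qed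

lemma lin_part_smult:
  assumes "linear f"
  shows "lin_part f (a *s u) = a *s lin_part f u"
proof -
  have eq: "lin_part f (a *s u) = (1 / 2) *s (f (a *s u) - \<i> *s f ((\<i> * a) *s u))"
    by (simp add: lin_part_def vector_smult_assoc)
  show ?thesis
    unfolding eq linear_vector_smult_split[OF assms, of a u]
      linear_vector_smult_split[OF assms, of "\<i> * a" u]
    by (simp add: lin_part_def vec_eq_iff complex_eq_iff field_simps)
qed

lemma antilin_part_smult:
  assumes "linear f"
  shows "antilin_part f (a *s u) = cnj a *s antilin_part f u"
proof -
  have eq: "antilin_part f (a *s u) = (1 / 2) *s (f (a *s u) + \<i> *s f ((\<i> * a) *s u))"
    by (simp add: antilin_part_def vector_smult_assoc)
  show ?thesis
    unfolding eq linear_vector_smult_split[OF assms, of a u]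
      linear_vector_smult_split[OF assms, of "\<i> * a" u]
    by (simp add: antilin_part_def vec_eq_iff complex_eq_iff field_simps)
qed

lemma lin_part_add:
  "linear f \<Longrightarrow> lin_part f (u + v) = lin_part f u + lin_part f v"
  by (simp add: lin_part_def linear_add vector_add_ldistrib vec_eq_iff algebra_simps)

lemma antilin_part_add:
  "linear f \<Longrightarrow> antilin_part f (u + v) = antilin_part f u + antilin_part f v"
  by (simp add: antilin_part_def linear_add vector_add_ldistrib vec_eq_iff algebra_simps)

text \<open>The scalar map \<open>\<sigma>\<close> is the identity for complex linear maps and
  conjugation for antilinear ones.\<close>

lemma semilinear_expansion:
  fixes f :: "complex^'n::finite \<Rightarrow> complex^'m"
  assumes "\<And>u v. f (u + v) = f u + f v" and "\<And>a u. f (a *s u) = \<sigma> a *s f u"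
  shows "f u = (\<Sum>j\<in>UNIV. \<sigma> (u $ j) *s f (axis j 1))"
proof -
  have "f 0 = 0" using assms(1)[of 0 0] by simp
  then have "f (\<Sum>j\<in>I. g j) = (\<Sum>j\<in>I. f (g j))" for I :: "'n set" and g
    by (induction I rule: infinite_finite_induct) (simp_all add: assms(1))
  from this[of "\<lambda>j. u $ j *s axis j 1" UNIV] show ?thesis
    by (simp add: basis_expansion assms(2))
qed

lemmas lin_part_expansion = semilinear_expansion[of "lin_part f" "\<lambda>a. a" for f, OF lin_part_add lin_part_smult]
lemmas antilin_part_expansion = semilinear_expansion[of "antilin_part f" cnj for f, OF antilin_part_add antilin_part_smult]

lemma frechet_derivative_vec_nth:
  assumes "f differentiable (at z)"
  shows "frechet_derivative (\<lambda>w. f w $ k) (at z) u = frechet_derivative f (at z) u $ k"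
proof -
  have "((\<lambda>w. f w $ k) has_derivative (\<lambda>u. frechet_derivative f (at z) u $ k)) (at z)"
    using bounded_linear.has_derivative[OF bounded_linear_vec_nth
        assms[unfolded frechet_derivative_works]] .
  then show ?thesis
    by (rule fun_cong[OF frechet_derivative_at, symmetric])
qed

lemma vector_smult_axis: "(a :: complex) *s axis k b = axis k (a * b)"
  by (auto simp: vec_eq_iff axis_def)

text \<open>The directions of \<open>d_x\<close> and \<open>d_y\<close> differ by the factor \<i>,
  so the Wirtinger derivative is the complex linear part in a coordinate direction.\<close>

lemma d_z_vec_nth:
  assumes "f differentiable (at z)"
  shows "d_z j (\<lambda>w. f w $ k) z = lin_part (frechet_derivative f (at z)) (axis j 1) $ k"
  by (simp add: d_z_def d_x_def d_y_def lin_part_def frechet_derivative_vec_nth assms vector_smult_axis)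

text \<open>The sum over coordinates in the bracket is the expansion of the complex linear part of a
  derivative, so the formula of the real bracket persists with derivatives replaced by their complex
  linear parts.\<close>

lemma complex_lie_pointwise:
  fixes X Y :: "(complex^'n::finite) vfield"
  assumes "X differentiable (at z)" "Y differentiable (at z)"
  shows "complex_lie X Y z =
    lin_part (frechet_derivative Y (at z)) (X z) - lin_part (frechet_derivative X (at z)) (Y z)"
proof -
  have lin: "linear (frechet_derivative X (at z))" "linear (frechet_derivative Y (at z))"
    using assms linear_frechet_derivative by blast+
  show ?thesis
    unfolding lin_part_expansion[OF lin(2) lin(2), of "X z"] lin_part_expansion[OF lin(1) lin(1), of "Y z"]
    by (simp add: complex_lie_def d_z_vec_nth assms vec_eq_iff sum_subtractf)
qed

text \<open>Multiplication by \<open>L z\<close> commutes with \<i>, so taking complex linear parts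
  of the product rule gives a product rule again.\<close>

lemma complex_haantjes_pointwise:
  fixes L :: "complex^'n \<Rightarrow> complex^'n^'n::finite"
  assumes L: "L differentiable (at z)" and XY: "X differentiable (at z)" "Y differentiable (at z)"
  shows "haantjes complex_lie (matrix_action L) X Y z =
    haantjes_form ((*v) (L z)) (\<lambda>u v. lin_part (\<lambda>u. frechet_derivative L (at z) u *v v) u) (X z) (Y z)"
proof (rule haantjes_pointwise[where \<delta> = "\<lambda>X. lin_part (frechet_derivative X (at z))"])
  fix X :: "(complex^'n) vfield" and u
  assume X: "X differentiable (at z)"
  show "lin_part (frechet_derivative (matrix_action L X) (at z)) u =
     lin_part (\<lambda>u. frechet_derivative L (at z) u *v X z) u +
     L z *v lin_part (frechet_derivative X (at z)) u"
    by (simp add: lin_part_def frechet_derivative_matrix_action L X vector_scalar_commute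
      matrix_vector_mult_diff_distrib vector_add_ldistrib vec.scale_right_diff_distrib)
qed (use XY in \<open>auto simp: matrix_action_def linear_matrix_vector_mult_complex complex_lie_pointwise
       intro: differentiable_matrix_action[unfolded matrix_action_def] L\<close>)

lemma real_haantjes_pointwise:
  fixes L :: "complex^'n \<Rightarrow> complex^'n^'n::finite"
  assumes L: "L differentiable (at z)" and XY: "X differentiable (at z)" "Y differentiable (at z)"
  shows "haantjes real_lie (matrix_action L) X Y z =
    haantjes_form ((*v) (L z)) (\<lambda>u v. frechet_derivative L (at z) u *v v) (X z) (Y z)"
  by (rule haantjes_pointwise[where \<delta> = "\<lambda>X. frechet_derivative X (at z)"])
     (use XY in \<open>auto simp: matrix_action_def real_lie_def linear_matrix_vector_mult_complex
        frechet_derivative_matrix_action[unfolded matrix_action_def] L intro: differentiable_matrix_action[unfolded matrix_action_def] L\<close>)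

lemma antilin_part_axis_frechet_derivative_matrix:
  fixes L :: "complex^'n \<Rightarrow> complex^'n^'n::finite"
  assumes "L differentiable (at z)"
  shows "antilin_part (\<lambda>u. frechet_derivative L (at z) u *v v) (axis \<alpha> 1) = d_zbar_matrix \<alpha> L z *v v"
proof -
  have L': "(\<lambda>w. L w $ i) differentiable (at z)" for i
    using bounded_linear.has_derivative[OF bounded_linear_vec_nth] assms
    unfolding differentiable_def by blast
  have "frechet_derivative (\<lambda>w. L w $ i $ j) (at z) u = frechet_derivative L (at z) u $ i $ j" for i j u
    by (simp add: frechet_derivative_vec_nth assms L')
  then show ?thesis
    by (simp add: vec_eq_iff antilin_part_def d_zbar_matrix_def d_zbar_def d_x_def d_y_def
        matrix_vector_mult_def vector_smult_axis sum_distrib_left sum.distrib[symmetric] algebra_simps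
        add_divide_distrib)
qed

text \<open>The antilinear part in direction \<open>u\<close> is the combination of the matrices
  \<open>d_zbar_matrix \<alpha> L z\<close> with coefficients \<open>cnj (u $ \<alpha>)\<close>, so
  coordinate directions decide whether all directions commute with \<open>L z\<close>.\<close>

lemma commute_antilin_part_iff:
  fixes L :: "complex^'n \<Rightarrow> complex^'n^'n::finite"
  assumes "L differentiable (at z)"
  defines "D \<equiv> \<lambda>u v. antilin_part (\<lambda>u. frechet_derivative L (at z) u *v v) u"
  shows "(\<forall>\<alpha>. d_zbar_matrix \<alpha> L z ** L z = L z ** d_zbar_matrix \<alpha> L z) \<longleftrightarrow>
    (\<forall>u v. D u (L z *v v) = L z *v D u v)"
proof -
  note lin = linear_matrix_vector_mult_left[OF linear_frechet_derivative[OF assms(1)]]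
  have D: "D u v = (\<Sum>\<alpha>\<in>UNIV. cnj (u $ \<alpha>) *s (d_zbar_matrix \<alpha> L z *v v))" for u v
    unfolding D_def antilin_part_expansion[OF lin lin, of v u]
      antilin_part_axis_frechet_derivative_matrix[OF assms(1)] ..
  have axis: "D (axis \<alpha> 1) v = d_zbar_matrix \<alpha> L z *v v" for \<alpha> v
    unfolding D_def by (rule antilin_part_axis_frechet_derivative_matrix[OF assms(1)])
  show ?thesis
  proof
    assume *: "\<forall>\<alpha>. d_zbar_matrix \<alpha> L z ** L z = L z ** d_zbar_matrix \<alpha> L z"
    show "\<forall>u v. D u (L z *v v) = L z *v D u v"
      by (simp add: D linear_sum[OF linear_matrix_vector_mult_complex] vector_scalar_commute
          matrix_vector_mul_assoc *)
  next
    assume *: "\<forall>u v. D u (L z *v v) = L z *v D u v"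
    have "(d_zbar_matrix \<alpha> L z ** L z) *v v = (L z ** d_zbar_matrix \<alpha> L z) *v v" for \<alpha> v
      using * axis by (metis matrix_vector_mul_assoc)
    then show "\<forall>\<alpha>. d_zbar_matrix \<alpha> L z ** L z = L z ** d_zbar_matrix \<alpha> L z"
      by (simp add: matrix_eq)
  qed
qed


section \<open>Comparison of the real and the complex torsion at a point\<close>

lemma haantjes_form_eq_0_if_axis:
  fixes T :: "complex^'n::finite \<Rightarrow> complex^'n"
  assumes T: "linear T" "\<And>a u. T (a *s u) = a *s T u"
    and D_add: "\<And>u u' v. D (u + u') v = D u v + D u' v" "\<And>u v v'. D u (v + v') = D u v + D u v'"
    and D_smult: "\<And>a u v. D (a *s u) v = a *s D u v" "\<And>a u v. D u (a *s v) = a *s D u v"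
    and axis: "\<And>\<alpha> \<beta>. haantjes_form T D (axis \<alpha> 1) (axis \<beta> 1) = 0"
  shows "haantjes_form T D u v = 0"
proof -
  note defs = haantjes_form_def nijenhuis_form_def linear_add[OF T(1)] linear_diff[OF T(1)]
  \<comment> \<open>Complex linearity of \<open>T\<close> and of \<open>D\<close> in both arguments
    makes the torsion form complex bilinear.\<close>
  have left: "haantjes_form T D u v = (\<Sum>j\<in>UNIV. u $ j *s haantjes_form T D (axis j 1) v)" for u v
    by (rule semilinear_expansion[of "\<lambda>u. haantjes_form T D u v" "\<lambda>a. a"])
       (simp_all add: defs T(2) D_add D_smult, simp_all add: vec_eq_iff algebra_simps)
  have right: "haantjes_form T D u v = (\<Sum>j\<in>UNIV. v $ j *s haantjes_form T D u (axis j 1))" for u v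
    by (rule semilinear_expansion[of "haantjes_form T D u" "\<lambda>a. a"])
       (simp_all add: defs T(2) D_add D_smult, simp_all add: vec_eq_iff algebra_simps)
  show ?thesis
    by (subst left, subst right) (simp add: axis)
qed

text \<open>Replacing \<open>v\<close> by \<open>\<i> v\<close> separates the three parts of the torsion by their types.\<close>

lemma haantjes_form_type_separation:
  fixes T :: "complex^'n::finite \<Rightarrow> complex^'n"
  assumes T: "linear T" "\<And>a u. T (a *s u) = a *s T u"
    and D: "\<And>a u v. D (a *s u) v = a *s D u v" "\<And>a u v. D u (a *s v) = a *s D u v"
    and E: "\<And>a u v. E (a *s u) v = cnj a *s E u v" "\<And>a u v. E u (a *s v) = a *s E u v"
    and eq_0: "\<And>u v. haantjes_form T (\<lambda>u v. D u v + E u v) u v = 0"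
  shows "haantjes_form T D u v = 0" and "haantjes_half T E u v = 0"
proof -
  have eq: "haantjes_form T D u v + (haantjes_half T E u v - haantjes_half T E v u) = 0" for u v
    using eq_0[of u v] by (simp add: haantjes_form_add[OF T(1)] haantjes_form_half[OF T(1), of E])
  have half_0: "haantjes_half T E v u = 0" for u v
  proof -
    \<comment> \<open>Passing from \<open>v\<close> to \<i> v multiplies every term by \<i>, except
      that the half with \<open>v\<close> in its antilinear first slot gets -\<i>. That half thus
      changes sign relative to the others, and comparison with the relation at (u, v) leaves twice
      its value.\<close>
    have "\<i> *s (haantjes_form T D u v + haantjes_half T E u v + haantjes_half T E v u) =
        haantjes_form T D u (\<i> *s v) + (haantjes_half T E u (\<i> *s v) - haantjes_half T E (\<i> *s v) u)"
      by (simp add: haantjes_form_def nijenhuis_form_def haantjes_half_def T linear_add[OF T(1)]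
          linear_diff[OF T(1)] linear_neg[OF T(1)] D E) (simp add: vec_eq_iff algebra_simps)
    then have "haantjes_form T D u v + haantjes_half T E u v + haantjes_half T E v u = 0"
      using eq[of u "\<i> *s v"] by (metis complex_i_not_zero vec.scale_eq_0_iff)
    then show ?thesis
      using eq[of u v] by (simp add: vec_eq_iff complex_eq_iff) (smt (verit))
  qed
  then show "haantjes_half T E u v = 0" .
  show "haantjes_form T D u v = 0"
    using eq[of u v] by (simp add: half_0)
qed

text \<open>For fixed \<open>v\<close> the commutator is an antilinear function of \<open>u\<close>,
  and the vanishing of the half is, up to sign, the quadratic relation of
  \<open>antilinear_double_intertwiner_eq_0\<close>.\<close>

lemma commute_if_haantjes_half_eq_0:
  fixes B :: "complex^'n^'n::finite"
  assumes D: "\<And>u u' v. D (u - u') v = D u v - D u' v"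
     "\<And>a u v. D (a *s u) v = cnj a *s D u v"
    and eq_0: "\<And>u v. haantjes_half ((*v) B) D u v = 0"
    and eig: "\<And>\<mu>. is_eigenvalue B \<mu> \<Longrightarrow> Im \<mu> > 0"
  shows "D u (B *v v) = B *v D u v"
proof -
  define E where "E u = B *v D u v - D u (B *v v)" for u
  have "E u = 0"
  proof (rule antilinear_double_intertwiner_eq_0[where E = E and B = B])
    fix u
    show "E (B *v (B *v u)) - 2 *s (B *v E (B *v u)) + B *v (B *v E u) = 0"
      using eq_0[of u v]
      by (simp add: E_def haantjes_half_def matrix_vector_mult_diff_distrib vec_eq_iff algebra_simps)
  qed (simp_all add: E_def D eig matrix_vector_mult_diff_distrib vector_scalar_commute
         vec.scale_right_diff_distrib)
  then show ?thesis by (simp add: E_def)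
qed

lemma lin_part_matrix_right:
  fixes f :: "complex^'n::finite \<Rightarrow> complex^'n^'n::finite"
  shows "lin_part (\<lambda>u. f u *v (v + v')) u = lin_part (\<lambda>u. f u *v v) u + lin_part (\<lambda>u. f u *v v') u"
    and "lin_part (\<lambda>u. f u *v (a *s v)) u = a *s lin_part (\<lambda>u. f u *v v) u"
    and "antilin_part (\<lambda>u. f u *v (v + v')) u = antilin_part (\<lambda>u. f u *v v) u + antilin_part (\<lambda>u. f u *v v') u"
    and "antilin_part (\<lambda>u. f u *v (a *s v)) u = a *s antilin_part (\<lambda>u. f u *v v) u"
  by (simp_all add: lin_part_def antilin_part_def matrix_vector_right_distrib vector_scalar_commute
      vec_eq_iff algebra_simps)

text \<open>The form is additive in the derivative of the operator. Its complex linear part is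
  controlled by the coordinate fields, and its antilinear part contributes two halves that vanish by
  commutation.\<close>

lemma haantjes_form_real_eq_0:
  fixes f :: "complex^'n::finite \<Rightarrow> complex^'n^'n::finite"
  assumes f: "linear f"
    and commute: "\<And>u v. antilin_part (\<lambda>u. f u *v (B *v v)) u = B *v antilin_part (\<lambda>u. f u *v v) u"
    and axis: "\<And>\<alpha> \<beta>. haantjes_form ((*v) B) (\<lambda>u v. lin_part (\<lambda>u. f u *v v) u) (axis \<alpha> 1) (axis \<beta> 1) = 0"
  shows "haantjes_form ((*v) B) (\<lambda>u v. f u *v v) u v = 0"
proof -
  note B = linear_matrix_vector_mult_complex[of B]
  note lin = linear_matrix_vector_mult_left[OF f]
  have "haantjes_form ((*v) B) (\<lambda>u v. lin_part (\<lambda>u. f u *v v) u) u v = 0"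
    by (rule haantjes_form_eq_0_if_axis[OF B vector_scalar_commute])
       (simp_all add: lin_part_add[OF lin] lin_part_smult[OF lin]
          lin_part_matrix_right axis)
  moreover have "haantjes_form ((*v) B) (\<lambda>u v. antilin_part (\<lambda>u. f u *v v) u) u v = 0"
    using haantjes_half_eq_0[OF B, of "\<lambda>u v. antilin_part (\<lambda>u. f u *v v) u"]
    by (simp add: haantjes_form_half[OF B] commute)
  ultimately show ?thesis
    using haantjes_form_add[OF B, of "\<lambda>u v. lin_part (\<lambda>u. f u *v v) u"
        "\<lambda>u v. antilin_part (\<lambda>u. f u *v v) u" u v]
    by (simp add: lin_part_add_antilin_part)
qed

lemma haantjes_form_complex_eq_0:
  fixes f :: "complex^'n::finite \<Rightarrow> complex^'n^'n::finite"
  assumes f: "linear f"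
    and eig: "\<And>\<mu>. is_eigenvalue B \<mu> \<Longrightarrow> Im \<mu> > 0"
    and eq_0: "\<And>u v. haantjes_form ((*v) B) (\<lambda>u v. f u *v v) u v = 0"
  shows "antilin_part (\<lambda>u. f u *v (B *v v)) u = B *v antilin_part (\<lambda>u. f u *v v) u"
    and "haantjes_form ((*v) B) (\<lambda>u v. lin_part (\<lambda>u. f u *v v) u) u v = 0"
proof -
  define D where "D u v = lin_part (\<lambda>u. f u *v v) u" for u v
  define E where "E u v = antilin_part (\<lambda>u. f u *v v) u" for u v
  note B = linear_matrix_vector_mult_complex[of B]
  note lin = linear_matrix_vector_mult_left[OF f]
  have "haantjes_form ((*v) B) D u v = 0" "haantjes_half ((*v) B) E u v = 0" for u v
    using haantjes_form_type_separation[OF B vector_scalar_commute, of D E] eq_0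
    by (simp_all add: D_def E_def lin_part_smult[OF lin]
        antilin_part_smult[OF lin] lin_part_matrix_right lin_part_add_antilin_part)
  moreover have "E (u - u') v = E u v - E u' v" for u u' v
    using antilin_part_add[OF lin, of v "u - u'" u'] by (simp add: E_def algebra_simps)
  moreover have "E (a *s u) v = cnj a *s E u v" for a u v
    by (simp add: E_def antilin_part_smult[OF lin])
  ultimately show "antilin_part (\<lambda>u. f u *v (B *v v)) u = B *v antilin_part (\<lambda>u. f u *v v) u"
    and "haantjes_form ((*v) B) (\<lambda>u v. lin_part (\<lambda>u. f u *v v) u) u v = 0"
    using commute_if_haantjes_half_eq_0[of E B] eig by (simp_all add: E_def D_def[abs_def])
qed

subsection \<open>Smooth functions\<close>

lemma Ck_on_subset: "Ck_on k S f \<Longrightarrow> T \<subseteq> S \<Longrightarrow> Ck_on k T f"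
  by (induction k arbitrary: f) (auto intro: continuous_on_subset)

lemma Ck_on_SucD: "Ck_on (Suc k) S f \<Longrightarrow> Ck_on k S f"
proof (induction k arbitrary: f)
  case 0
  then show ?case
    by (auto intro!: continuous_at_imp_continuous_on differentiable_imp_continuous_within)
next
  case (Suc k)
  then show ?case by (metis Ck_on.simps(2))
qed

lemma differentiable_cong_open:
  assumes "open S" "x \<in> S" "\<And>y. y \<in> S \<Longrightarrow> f y = g y"
  shows "f differentiable (at x) \<longleftrightarrow> g differentiable (at x)"
  using has_derivative_transform_within_open[of f _ x UNIV S g]
    has_derivative_transform_within_open[of g _ x UNIV S f] assms
  unfolding differentiable_def by metis

lemma Ck_on_cong:
  assumes "open S" "\<And>x. x \<in> S \<Longrightarrow> f x = g x"
  shows "Ck_on k S f \<longleftrightarrow> Ck_on k S g"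
  using assms(2)
proof (induction k arbitrary: f g)
  case 0
  then show ?case by (simp cong: continuous_on_cong)
next
  case (Suc k)
  have diff: "f differentiable (at x) \<longleftrightarrow> g differentiable (at x)" if "x \<in> S" for x
    using differentiable_cong_open[OF assms(1) that] Suc.prems by blast
  have "frechet_derivative f (at x) = frechet_derivative g (at x)"
    if "x \<in> S" "f differentiable (at x)" for x
    using frechet_derivative_transform_within_open[OF that(2) assms(1) that(1)] Suc.prems by blast
  then have "Ck_on k S (\<lambda>x. frechet_derivative f (at x) v) \<longleftrightarrow>
      Ck_on k S (\<lambda>x. frechet_derivative g (at x) v)" if "\<forall>x\<in>S. f differentiable (at x)" for v
    by (intro Suc.IH) (use that in auto)
  then show ?case
    using diff by auto
qed

text \<open>Derivatives are taken at points of the whole space rather than within the set, so they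
  are the same for every neighbourhood.\<close>

lemma Ck_on_local:
  assumes "\<And>x. x \<in> S \<Longrightarrow> \<exists>U. open U \<and> x \<in> U \<and> Ck_on k U f"
  shows "Ck_on k S f"
  using assms
proof (induction k arbitrary: f)
  case 0
  then show ?case
    by (metis Ck_on.simps(1) continuous_at_imp_continuous_on continuous_on_eq_continuous_at)
next
  case (Suc k)
  have "f differentiable (at x)" if "x \<in> S" for x
    using Suc.prems[OF that] by auto
  moreover have "Ck_on k S (\<lambda>x. frechet_derivative f (at x) v)" for v
    by (rule Suc.IH) (use Suc.prems in force)
  ultimately show ?case by simp
qed

text \<open>Introduction rule for explicit derivative formulas, which agree with
  \<open>frechet_derivative\<close> only on \<open>S\<close>.\<close>

lemma Ck_on_Suc_has_derivative:
  assumes "open S" and "\<And>x. x \<in> S \<Longrightarrow> (f has_derivative f' x) (at x)"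
    and "\<And>v. Ck_on k S (\<lambda>x. f' x v)"
  shows "Ck_on (Suc k) S f"
proof -
  have "f' x = frechet_derivative f (at x)" if "x \<in> S" for x
    using assms(2)[OF that] by (rule frechet_derivative_at)
  then have "Ck_on k S (\<lambda>x. frechet_derivative f (at x) v)" for v
    using assms(3)[of v] by (subst Ck_on_cong[OF assms(1), of _ "\<lambda>x. f' x v"]) auto
  then show ?thesis
    using assms(2) by (auto simp: differentiable_def)
qed

lemma Ck_on_Suc_derivative:
  assumes "Ck_on (Suc k) S f" "x \<in> S"
  shows "(f has_derivative frechet_derivative f (at x)) (at x)"
  using assms frechet_derivative_works by auto

lemma Ck_on_const: "Ck_on k S (\<lambda>x. c)"
  by (induction k arbitrary: c) auto

lemma Ck_on_bounded_linear:
  assumes "bounded_linear h" "open S"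
  shows "Ck_on k S h"
proof (cases k)
  case 0
  then show ?thesis
    using assms(1) by (simp add: linear_continuous_on)
next
  case (Suc k')
  then show ?thesis
    using Ck_on_Suc_has_derivative[OF assms(2), of h "\<lambda>x. h"]
      bounded_linear_imp_has_derivative[OF assms(1)] Ck_on_const by metis
qed

lemma Ck_on_add:
  assumes "open S" "Ck_on k S f" "Ck_on k S g"
  shows "Ck_on k S (\<lambda>x. f x + g x)"
  using assms(2,3)
proof (induction k arbitrary: f g)
  case 0
  then show ?case by (simp add: continuous_on_add)
next
  case (Suc k)
  show ?case
    by (rule Ck_on_Suc_has_derivative[OF assms(1), of _
          "\<lambda>x v. frechet_derivative f (at x) v + frechet_derivative g (at x) v"])
       (use Suc in \<open>auto intro!: has_derivative_add Ck_on_Suc_derivative\<close>)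
qed

lemma Ck_on_sum:
  assumes "open S" "\<And>i. i \<in> I \<Longrightarrow> Ck_on k S (f i)"
  shows "Ck_on k S (\<lambda>x. \<Sum>i\<in>I. f i x)"
  using assms(2)
  by (induction I rule: infinite_finite_induct) (auto intro: Ck_on_add[OF assms(1)] Ck_on_const)

lemma Ck_on_bilinear:
  assumes "bounded_bilinear h" "open S" "Ck_on k S f" "Ck_on k S g"
  shows "Ck_on k S (\<lambda>x. h (f x) (g x))"
  using assms(3,4)
proof (induction k arbitrary: f g)
  case 0
  then show ?case
    using bounded_bilinear.continuous_on[OF assms(1)] by simp
next
  case (Suc k)
  note fg = Suc.prems[THEN Ck_on_SucD]
  show ?case
  proof (rule Ck_on_Suc_has_derivative[OF assms(2)])
    show "((\<lambda>x. h (f x) (g x)) has_derivative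
      (\<lambda>v. h (f x) (frechet_derivative g (at x) v) + h (frechet_derivative f (at x) v) (g x))) (at x)"
      if "x \<in> S" for x
      using bounded_bilinear.FDERIV[OF assms(1) Suc.prems[THEN Ck_on_Suc_derivative, OF that]] .
    show "Ck_on k S (\<lambda>x. h (f x) (frechet_derivative g (at x) v) + h (frechet_derivative f (at x) v) (g x))" for v
      by (intro Ck_on_add[OF assms(2)] Suc.IH fg) (use Suc.prems in auto)
  qed
qed

lemma Ck_on_compose:
  fixes f :: "'a::real_normed_vector \<Rightarrow> 'b::euclidean_space" and g :: "'b \<Rightarrow> 'c::real_normed_vector"
  assumes "open S" "open T" "Ck_on k S f" "Ck_on k T g" "f ` S \<subseteq> T"
  shows "Ck_on k S (\<lambda>x. g (f x))"
  using assms(3-5)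
proof (induction k arbitrary: g)
  case 0
  then show ?case using continuous_on_compose2[of T g S f] by simp
next
  case (Suc k)
  have lin: "linear (frechet_derivative g (at (f x)))" if "x \<in> S" for x
    using Suc.prems that by (auto intro!: linear_frechet_derivative)
  show ?case
  proof (rule Ck_on_Suc_has_derivative[OF assms(1)])
    \<comment> \<open>\<open>Ck_on\<close> controls derivatives in fixed directions, while the chain
      rule differentiates \<open>g\<close> in a direction that moves with \<open>x\<close>.
      Expanding that direction in the basis leaves fixed directions with coefficients depending on
      \<open>x\<close>.\<close>
    show "((\<lambda>x. g (f x)) has_derivative
        (\<lambda>v. \<Sum>b\<in>Basis. (frechet_derivative f (at x) v \<bullet> b) *\<^sub>R frechet_derivative g (at (f x)) b)) (at x)"
      if "x \<in> S" for x
    proof -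
      have "f x \<in> T" using Suc.prems(3) that by auto
      then have "(g \<circ> f has_derivative frechet_derivative g (at (f x)) \<circ> frechet_derivative f (at x)) (at x)"
        using Suc.prems(1,2) that by (intro diff_chain_at Ck_on_Suc_derivative)
      moreover have "frechet_derivative g (at (f x)) \<circ> frechet_derivative f (at x) =
          (\<lambda>v. \<Sum>b\<in>Basis. (frechet_derivative f (at x) v \<bullet> b) *\<^sub>R frechet_derivative g (at (f x)) b)"
        by (simp add: fun_eq_iff linear_sum[OF lin[OF that], symmetric]
            linear_cmul[OF lin[OF that], symmetric] euclidean_representation)
      ultimately show ?thesis by (simp add: o_def)
    qed
    have f: "Ck_on k S f" using Suc.prems(1) by (rule Ck_on_SucD)
    show "Ck_on k S (\<lambda>x. \<Sum>b\<in>Basis. (frechet_derivative f (at x) v \<bullet> b) *\<^sub>R frechet_derivative g (at (f x)) b)" for v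
    proof (intro Ck_on_sum[OF assms(1)] Ck_on_bilinear[OF bounded_bilinear_scaleR assms(1)]
          Ck_on_bilinear[OF bounded_bilinear_inner assms(1)] Ck_on_const)
      show "Ck_on k S (\<lambda>x. frechet_derivative f (at x) v)"
        using Suc.prems(1) by simp
      show "Ck_on k S (\<lambda>x. frechet_derivative g (at (f x)) b)" for b
        by (rule Suc.IH[OF f]) (use Suc.prems in auto)
    qed
  qed
qed

lemma smooth_on_subset: "smooth_on S f \<Longrightarrow> T \<subseteq> S \<Longrightarrow> smooth_on T f"
  by (auto simp: smooth_on_def intro: Ck_on_subset)

lemma smooth_on_const: "smooth_on S (\<lambda>x. c)"
  by (simp add: smooth_on_def Ck_on_const)

lemma smooth_on_cong:
  "open S \<Longrightarrow> (\<And>x. x \<in> S \<Longrightarrow> f x = g x) \<Longrightarrow> smooth_on S f \<longleftrightarrow> smooth_on S g"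
  using Ck_on_cong unfolding smooth_on_def by metis

lemma smooth_on_local:
  assumes "\<And>x. x \<in> S \<Longrightarrow> \<exists>U. open U \<and> x \<in> U \<and> smooth_on U f"
  shows "smooth_on S f"
  using assms unfolding smooth_on_def by (metis Ck_on_local)

lemma smooth_on_bilinear:
  "bounded_bilinear h \<Longrightarrow> open S \<Longrightarrow> smooth_on S f \<Longrightarrow> smooth_on S g \<Longrightarrow> smooth_on S (\<lambda>x. h (f x) (g x))"
  by (simp add: smooth_on_def Ck_on_bilinear)

lemma smooth_on_compose:
  fixes f :: "'a::real_normed_vector \<Rightarrow> 'b::euclidean_space" and g :: "'b \<Rightarrow> 'c::real_normed_vector"
  assumes "open S" "open T" "smooth_on S f" "smooth_on T g" "f ` S \<subseteq> T"
  shows "smooth_on S (\<lambda>x. g (f x))"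
  using assms by (simp add: smooth_on_def Ck_on_compose)

lemma smooth_on_frechet_derivative:
  "smooth_on S f \<Longrightarrow> smooth_on S (\<lambda>x. frechet_derivative f (at x) v)"
  using Ck_on.simps(2)[of _ S f] by (simp add: smooth_on_def)

lemma smooth_on_differentiable: "smooth_on S f \<Longrightarrow> x \<in> S \<Longrightarrow> f differentiable (at x)"
  unfolding smooth_on_def by (meson Ck_on.simps(2))

section \<open>A smooth bump function\<close>

definition exp_recip :: "nat \<Rightarrow> real \<Rightarrow> real" where
  "exp_recip m t = (if t > 0 then exp (- 1 / t) / t ^ m else 0)"

text \<open>From the right, the substitution s = 1/t turns the function into s^m / exp s for s
  tending to infinity.\<close>

lemma tendsto_exp_recip: "(exp_recip m \<longlongrightarrow> 0) (at 0)"
proof (rule filterlim_split_at)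
  have "exp_recip m t = 0" if "t < 0" for t
    using that by (simp add: exp_recip_def)
  then show "(exp_recip m \<longlongrightarrow> 0) (at_left 0)"
    by (intro tendsto_eventually) (auto simp: eventually_at_left_field intro!: exI[of _ "-1"])
  have "((\<lambda>t. inverse t ^ m / exp (inverse t)) \<longlongrightarrow> (0::real)) (at_right 0)"
    using filterlim_compose[OF tendsto_power_div_exp_0 filterlim_inverse_at_top_right] .
  moreover have "eventually (\<lambda>t. inverse t ^ m / exp (inverse t) = exp_recip m t) (at_right 0)"
    by (auto simp: eventually_at_right_field exp_recip_def exp_minus power_inverse field_simps intro!: exI[of _ 1])
  ultimately show "(exp_recip m \<longlongrightarrow> 0) (at_right 0)"
    using tendsto_cong by fast
qed

text \<open>The exponent \<open>m\<close> makes the family closed under differentiation up to linear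
  combinations, so that smoothness follows by induction. At 0 the difference quotient is the next
  member of the family, which tends to 0.\<close>

lemma exp_recip_has_real_derivative:
  "(exp_recip m has_real_derivative (exp_recip (m + 2) t - real m * exp_recip (m + 1) t)) (at t)"
proof -
  consider "t < 0" | "t = 0" | "t > 0" by linarith
  then show ?thesis
  proof cases
    case 1
    have "((\<lambda>t. 0) has_real_derivative 0) (at t)" by simp
    then have "(exp_recip m has_real_derivative 0) (at t)"
      by (rule has_field_derivative_transform_within_open[of _ _ _ "{..<0}"]) (use 1 in \<open>auto simp: exp_recip_def\<close>)
    then show ?thesis using 1 by (simp add: exp_recip_def)
  next
    case 2
    have "exp_recip k 0 = 0" for k
      by (simp add: exp_recip_def)
    moreover have "exp_recip m h / h = exp_recip (Suc m) h" for h
      by (auto simp: exp_recip_def)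
    ultimately show ?thesis
      using 2 tendsto_exp_recip[of "Suc m"] by (simp add: DERIV_def)
  next
    case 3
    have "((\<lambda>t. exp (- 1 / t) / t ^ m) has_real_derivative
        exp (- 1 / t) / t ^ (m + 2) - real m * (exp (- 1 / t) / t ^ (m + 1))) (at t)"
      using 3 by (cases m) (auto intro!: derivative_eq_intros simp: field_simps power2_eq_square,
          metis One_nat_def mult.commute neq0_conv power_minus_mult)
    then have "(exp_recip m has_real_derivative
        exp (- 1 / t) / t ^ (m + 2) - real m * (exp (- 1 / t) / t ^ (m + 1))) (at t)"
      by (rule has_field_derivative_transform_within_open[of _ _ _ "{0<..}"]) (use 3 in \<open>auto simp: exp_recip_def\<close>)
    then show ?thesis using 3 by (simp add: exp_recip_def)
  qed
qed

lemma smooth_on_exp_recip: "smooth_on UNIV (exp_recip m)"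
proof -
  have "Ck_on k UNIV (exp_recip m)" for k
  proof (induction k arbitrary: m)
    case 0
    then show ?case
      by (auto intro!: continuous_at_imp_continuous_on DERIV_isCont[OF exp_recip_has_real_derivative])
  next
    case (Suc k)
    show ?case
    proof (rule Ck_on_Suc_has_derivative)
      show "(exp_recip m has_derivative
          (\<lambda>v. (exp_recip (m + 2) t + (- real m) * exp_recip (m + 1) t) * v)) (at t)" for t
        using exp_recip_has_real_derivative[of m t] by (simp add: has_field_derivative_def)
      show "Ck_on k UNIV (\<lambda>t. (exp_recip (m + 2) t + (- real m) * exp_recip (m + 1) t) * v)" for v
        by (intro Ck_on_bilinear[OF bounded_bilinear_mult] Ck_on_add Ck_on_const Suc.IH open_UNIV)
    qed simp
  qed
  then show ?thesis by (simp add: smooth_on_def)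
qed

lemma smooth_bump:
  fixes z0 :: "'a::euclidean_space"
  assumes "r > 0"
  obtains \<phi> :: "'a \<Rightarrow> real" where "smooth_on UNIV \<phi>" "\<phi> z0 = 1" "\<And>z. z \<notin> cball z0 r \<Longrightarrow> \<phi> z = 0"
proof
  \<comment> \<open>Positive exactly in the open ball of radius \<open>r\<close>, with value r^2 at
    the centre; this explains the normalizing factor in \<open>\<phi>\<close>.\<close>
  define q where "q z = r\<^sup>2 - (z - z0) \<bullet> (z - z0)" for z
  define \<phi> where "\<phi> z = exp_recip 0 (q z) * inverse (exp_recip 0 (r\<^sup>2))" for z
  have sub: "Ck_on k UNIV (\<lambda>z. z - z0)" for k
    using Ck_on_add[OF open_UNIV Ck_on_bounded_linear[OF bounded_linear_ident open_UNIV] Ck_on_const, of k "- z0"]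
    by simp
  \<comment> \<open>The difference is written with the factor -1 to fit the rules for sums and
    bilinear products.\<close>
  have "Ck_on k UNIV (\<lambda>z. r\<^sup>2 + (- 1) * ((z - z0) \<bullet> (z - z0)))" for k
    by (intro Ck_on_add Ck_on_const Ck_on_bilinear[OF bounded_bilinear_mult]
        Ck_on_bilinear[OF bounded_bilinear_inner] sub open_UNIV)
  then have "smooth_on UNIV q"
    by (simp add: smooth_on_def q_def[abs_def])
  then have "smooth_on UNIV (\<lambda>z. exp_recip 0 (q z))"
    by (intro smooth_on_compose[OF _ _ _ smooth_on_exp_recip]) auto
  then show "smooth_on UNIV \<phi>"
    unfolding \<phi>_def[abs_def]
    by (intro smooth_on_bilinear[OF bounded_bilinear_mult] smooth_on_const) auto
  show "\<phi> z0 = 1"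
    using assms by (simp add: \<phi>_def q_def exp_recip_def)
  fix z assume "z \<notin> cball z0 r"
  then have "r\<^sup>2 < (norm (z - z0))\<^sup>2"
    using assms by (intro power_strict_mono) (auto simp: dist_norm norm_minus_commute)
  then have "q z \<le> 0"
    by (simp add: q_def power2_norm_eq_inner)
  then show "\<phi> z = 0"
    by (simp add: \<phi>_def exp_recip_def)
qed

subsection \<open>Vector fields with a prescribed value\<close>

lemma chart_homeomorphic:
  assumes "complex_manifold M A" "c \<in> A"
  shows "homeomorphic_map (subtopology M (fst c)) (top_of_set (chart_image c)) (snd c)"
    and "openin M (fst c)" and "open (chart_image c)"
    and "topspace (subtopology M (fst c)) = fst c"
  using assms openin_subset by (fastforce simp: complex_manifold_def topspace_subtopology)+

lemma chart_inj_on: "complex_manifold M A \<Longrightarrow> c \<in> A \<Longrightarrow> inj_on (snd c) (fst c)"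
  using chart_homeomorphic homeomorphic_imp_injective_map by metis

lemma chart_open_image:
  assumes "complex_manifold M A" "c \<in> A" "openin M U" "U \<subseteq> fst c"
  shows "open (snd c ` U)"
proof -
  have "openin (subtopology M (fst c)) U"
    using assms(3,4) by (simp add: openin_subtopology) blast
  then have "openin (top_of_set (chart_image c)) (snd c ` U)"
    using homeomorphic_imp_open_map[OF chart_homeomorphic(1)[OF assms(1,2)]]
    by (simp add: open_map_def)
  then show ?thesis
    using chart_homeomorphic(3)[OF assms(1,2)] openin_open_eq by blast
qed

lemma open_overlap: "complex_manifold M A \<Longrightarrow> c \<in> A \<Longrightarrow> d \<in> A \<Longrightarrow> open (overlap c d)"
  unfolding overlap_def by (rule chart_open_image) (auto intro: chart_homeomorphic(2))

lemma transition_apply: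
  assumes "complex_manifold M A" "c \<in> A" "p \<in> fst c"
  shows "transition c d (snd c p) = snd d p"
  using chart_inj_on[OF assms(1,2)] assms(3) by (simp add: transition_def)

lemma smooth_on_transition:
  "complex_manifold M A \<Longrightarrow> c \<in> A \<Longrightarrow> d \<in> A \<Longrightarrow> smooth_on (overlap c d) (transition c d)"
  by (simp add: complex_manifold_def holo_map_on_def)

lemma transition_has_derivative:
  assumes "complex_manifold M A" "c \<in> A" "d \<in> A" "p \<in> fst c" "p \<in> fst d"
  shows "(transition c d has_derivative d_transition c d (snd c p)) (at (snd c p))"
  using smooth_on_differentiable[OF smooth_on_transition[OF assms(1-3)]] assms(4,5)
  by (auto simp: overlap_def frechet_derivative_works[symmetric])

text \<open>The chain rule for the cocycle identity of coordinate changes. It yields the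
  transformation law for a vector transported from the chart \<open>c\<close> to the other
  charts.\<close>

lemma d_transition_compose:
  assumes M: "complex_manifold M A" and A: "c \<in> A" "d \<in> A" "e \<in> A"
    and p: "p \<in> fst c" "p \<in> fst d" "p \<in> fst e"
  shows "d_transition d e (snd d p) (d_transition c d (snd c p) v) = d_transition c e (snd c p) v"
proof -
  have "(transition d e \<circ> transition c d has_derivative
      d_transition d e (snd d p) \<circ> d_transition c d (snd c p)) (at (snd c p))"
    using diff_chain_at[OF transition_has_derivative[OF M A(1,2) p(1,2)], of "transition d e"]
      transition_has_derivative[OF M A(2,3) p(2,3)]
    by (simp add: transition_apply[OF M A(1) p(1)])
  then have "(transition c e has_derivative
      d_transition d e (snd d p) \<circ> d_transition c d (snd c p)) (at (snd c p))"
  proof (rule has_derivative_transform_within_open)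
    \<comment> \<open>The cocycle identity is available on the triple overlap, an open neighbourhood
      of the point.\<close>
    show "open (snd c ` (fst c \<inter> fst d \<inter> fst e))"
      by (rule chart_open_image[OF M A(1)])
         (use M A in \<open>auto intro!: openin_Int chart_homeomorphic(2)\<close>)
  qed (use M A p in \<open>auto simp: transition_apply\<close>)
  then show ?thesis
    using frechet_derivative_at by (metis comp_apply)
qed

lemma d_transition_self:
  assumes M: "complex_manifold M A" and c: "c \<in> A" and p: "p \<in> fst c"
  shows "d_transition c c (snd c p) v = v"
proof -
  have "((\<lambda>z. z) has_derivative (\<lambda>v. v)) (at (snd c p))" by simp
  then have "(transition c c has_derivative (\<lambda>v. v)) (at (snd c p))"
    by (rule has_derivative_transform_within_open[of _ _ _ _ "chart_image c"])
       (use chart_homeomorphic(3)[OF M c] p in \<open>auto simp: chart_image_def transition_apply[OF M c]\<close>)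
  then show ?thesis
    using frechet_derivative_at by metis
qed

text \<open>\<open>real_haantjes\<close> tests global fields only, so a tangent vector must be
  extended to the whole manifold: the constant field \<open>v\<close> of the chart \<open>c\<close>
  is cut off by a bump function and extended by zero.\<close>

lemma vector_field_through:
  fixes A :: "('m, 'n::finite) chart set"
  assumes M: "complex_manifold M A" and c: "c \<in> A" and z0: "z0 \<in> chart_image c"
  obtains X where "real_vector_field A X" "X c z0 = v"
proof -
  obtain r where r: "r > 0" "cball z0 r \<subseteq> chart_image c"
    using chart_homeomorphic(3)[OF M c] z0 open_contains_cball by blast
  obtain \<phi> :: "complex^'n \<Rightarrow> real" where \<phi>: "smooth_on UNIV \<phi>" "\<phi> z0 = 1"
      "\<And>z. z \<notin> cball z0 r \<Longrightarrow> \<phi> z = 0"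
    using smooth_bump[OF r(1)] by blast
  \<comment> \<open>\<open>K\<close> contains the points where the field can be nonzero. It is
    compact as the preimage of a closed ball under the chart, hence closed in the Hausdorff space
    \<open>M\<close>, so the extension by zero is smooth beyond the domain of
    \<open>c\<close>.\<close>
  define K where "K = {p \<in> fst c. snd c p \<in> cball z0 r}"
  have "snd c ` K = cball z0 r"
    using r(2) by (auto simp: K_def chart_image_def)
  moreover have "compactin (top_of_set (chart_image c)) (cball z0 r)"
    using r(2) by (simp add: compactin_subtopology)
  ultimately have "compactin (subtopology M (fst c)) K"
    using homeomorphic_map_compactness[OF chart_homeomorphic(1)[OF M c], of K]
      chart_homeomorphic(4)[OF M c] by (auto simp: K_def)
  then have "closedin M K"
    using M compactin_imp_closedin by (auto simp: compactin_subtopology complex_manifold_def)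
  \<comment> \<open>The components in the chart \<open>d\<close> of the cut-off constant field, as a
    function of the coordinates of \<open>c\<close>.\<close>
  define h where "h d z = \<phi> z *\<^sub>R d_transition c d z v" for d z
  define X where "X d w = (if w \<in> overlap d c then h d (transition d c w) else 0)" for d w
  have X: "X d (snd d p) = (if p \<in> fst c then \<phi> (snd c p) *\<^sub>R d_transition c d (snd c p) v else 0)"
    if "d \<in> A" "p \<in> fst d" for d p
    using that chart_inj_on[OF M that(1)]
    by (auto simp: X_def h_def overlap_def transition_apply[OF M] inj_on_def)
  have smooth: "smooth_on (chart_image d) (X d)" if d: "d \<in> A" for d
  proof (rule smooth_on_local)
    fix w assume "w \<in> chart_image d"
    then obtain p where p: "p \<in> fst d" "w = snd d p" by (auto simp: chart_image_def)
    show "\<exists>U. open U \<and> w \<in> U \<and> smooth_on U (X d)"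
    \<comment> \<open>On the domain of \<open>c\<close> the field is given by \<open>h\<close>; a
      point outside it has the complement of \<open>K\<close> as a neighbourhood, where the field
      vanishes.\<close>
    proof (cases "p \<in> fst c")
      case True
      have "smooth_on (overlap c d) (h d)"
        unfolding h_def[abs_def]
        by (intro smooth_on_bilinear[OF bounded_bilinear_scaleR] open_overlap[OF M c d]
            smooth_on_subset[OF \<phi>(1)] smooth_on_frechet_derivative smooth_on_transition[OF M c d]) auto
      then have "smooth_on (overlap d c) (\<lambda>w. h d (transition d c w))"
        by (rule smooth_on_compose[OF open_overlap[OF M d c] open_overlap[OF M c d]
              smooth_on_transition[OF M d c]])
           (auto simp: overlap_def transition_apply[OF M d])
      then have "smooth_on (overlap d c) (X d)"
        by (subst smooth_on_cong[OF open_overlap[OF M d c]]) (auto simp: X_def)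
      moreover have "w \<in> overlap d c" using p True by (auto simp: overlap_def)
      ultimately show ?thesis using open_overlap[OF M d c] by blast
    next
      case False
      define U where "U = snd d ` (fst d - K)"
      have "open U"
        unfolding U_def
        by (rule chart_open_image[OF M d])
           (use \<open>closedin M K\<close> chart_homeomorphic(2)[OF M d] in \<open>auto intro: openin_diff\<close>)
      moreover have "w \<in> U" using p False by (auto simp: U_def K_def)
      moreover have "X d u = 0" if "u \<in> U" for u
      proof -
        obtain p where p: "p \<in> fst d" "p \<notin> K" "u = snd d p" using \<open>u \<in> U\<close> by (auto simp: U_def)
        then have "\<phi> (snd c p) = 0" if "p \<in> fst c"
          using that by (intro \<phi>(3)) (auto simp: K_def)
        then show ?thesis using p by (simp add: X[OF d])
      qed
      then have "smooth_on U (X d)"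
        by (subst smooth_on_cong[OF \<open>open U\<close>, of _ "\<lambda>u. 0"]) (auto intro: smooth_on_const)
      ultimately show ?thesis by blast
    qed
  qed
  have "real_vector_field A X"
    unfolding real_vector_field_def
  proof (intro conjI ballI smooth)
    fix d e w assume de: "d \<in> A" "e \<in> A" and "w \<in> overlap d e"
    then obtain p where p: "p \<in> fst d" "p \<in> fst e" "w = snd d p" by (auto simp: overlap_def)
    have lin: "linear (d_transition d e w)"
      using transition_has_derivative[OF M de p(1,2)] p(3) has_derivative_linear by blast
    show "d_transition d e w (X d w) = X e (transition d e w)"
      using p de by (simp add: X transition_apply[OF M] linear_cmul[OF lin[unfolded p(3)]]
            linear_0[OF lin[unfolded p(3)]] d_transition_compose[OF M c de])
  qed
  moreover obtain p where "p \<in> fst c" "z0 = snd c p" using z0 by (auto simp: chart_image_def)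
  then have "X c z0 = v"
    using \<phi>(2) by (simp add: X[OF c] d_transition_self[OF M c])
  ultimately show ?thesis using that by blast
qed

lemma real_vector_field_differentiable:
  "real_vector_field A X \<Longrightarrow> c \<in> A \<Longrightarrow> z \<in> chart_image c \<Longrightarrow> X c differentiable (at z)"
  unfolding real_vector_field_def by (blast intro: smooth_on_differentiable)

theorem theorem6p2:
  fixes M :: "'m topology"
    and A :: "('m, 'n::finite) chart set"
    and L :: "('m, 'n) chart \<Rightarrow> complex^'n \<Rightarrow> complex^'n^'n"
  assumes "complex_manifold M A"
    and "endomorphism_field A L"
  shows "(complex_haantjes A L \<and> commutes_with_d_zbar A L \<longrightarrow> real_haantjes A L) \<and>
    (real_haantjes A L \<and>
       (\<forall>c\<in>A. \<forall>z\<in>chart_image c. \<forall>\<mu>. is_eigenvalue (L c z) \<mu> \<longrightarrow> Im \<mu> > 0) \<longrightarrow>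
     commutes_with_d_zbar A L \<and> complex_haantjes A L)"
proof (intro conjI impI)
  have diff: "L c differentiable (at z)" if "c \<in> A" "z \<in> chart_image c" for c z
    using assms(2) smooth_on_differentiable that by (auto simp: endomorphism_field_def)
  note lin = linear_frechet_derivative[OF diff]
  {
    assume *: "complex_haantjes A L \<and> commutes_with_d_zbar A L"
    show "real_haantjes A L"
      unfolding real_haantjes_def
    proof (intro allI impI ballI)
      fix X Y c z
      assume XY: "real_vector_field A X" "real_vector_field A Y" and c: "c \<in> A" "z \<in> chart_image c"
      have XY': "X c differentiable (at z)" "Y c differentiable (at z)"
        using XY c by (auto intro: real_vector_field_differentiable)
      \<comment> \<open>The coordinate fields are constant, so the complex hypothesis gives the
        algebraic form at pairs of axis vectors.\<close>
      have "haantjes_form ((*v) (L c z))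
          (\<lambda>u v. lin_part (\<lambda>u. frechet_derivative (L c) (at z) u *v v) u) (axis \<alpha> 1) (axis \<beta> 1) = 0" for \<alpha> \<beta>
        using * c complex_haantjes_pointwise[OF diff[OF c], of "coord_field \<alpha>" "coord_field \<beta>"]
        by (simp add: complex_haantjes_def coord_field_def)
      moreover have "antilin_part (\<lambda>u. frechet_derivative (L c) (at z) u *v (L c z *v v)) u =
          L c z *v antilin_part (\<lambda>u. frechet_derivative (L c) (at z) u *v v) u" for u v
        using * c commute_antilin_part_iff[OF diff[OF c]] by (simp add: commutes_with_d_zbar_def)
      ultimately show "haantjes real_lie (matrix_action (L c)) (X c) (Y c) z = 0"
        unfolding real_haantjes_pointwise[OF diff[OF c] XY'] by (intro haantjes_form_real_eq_0[OF lin[OF c]])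
    qed
  }
  assume *: "real_haantjes A L \<and>
    (\<forall>c\<in>A. \<forall>z\<in>chart_image c. \<forall>\<mu>. is_eigenvalue (L c z) \<mu> \<longrightarrow> Im \<mu> > 0)"
  \<comment> \<open>Any two tangent vectors at a point are values of global fields, so the torsion
    form vanishes on all pairs, in particular on (u, \<i> v), as the separation of types
    requires.\<close>
  have real_0: "haantjes_form ((*v) (L c z)) (\<lambda>u v. frechet_derivative (L c) (at z) u *v v) u v = 0"
    if c: "c \<in> A" "z \<in> chart_image c" for c z u v
  proof -
    obtain X Y where XY: "real_vector_field A X" "real_vector_field A Y" "X c z = u" "Y c z = v"
      using vector_field_through[OF assms(1) c] by metis
    then have "X c differentiable (at z)" "Y c differentiable (at z)"
      using c by (auto intro: real_vector_field_differentiable)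
    from real_haantjes_pointwise[OF diff[OF c] this] show ?thesis
      using * XY c by (simp add: real_haantjes_def)
  qed
  have complex_0:
    "antilin_part (\<lambda>u. frechet_derivative (L c) (at z) u *v (L c z *v v)) u =
      L c z *v antilin_part (\<lambda>u. frechet_derivative (L c) (at z) u *v v) u"
    "haantjes_form ((*v) (L c z)) (\<lambda>u v. lin_part (\<lambda>u. frechet_derivative (L c) (at z) u *v v) u) u v = 0"
    if c: "c \<in> A" "z \<in> chart_image c" for c z u v
    using haantjes_form_complex_eq_0[OF lin[OF c] _ real_0[OF c]] * c by blast+
  show "commutes_with_d_zbar A L"
    unfolding commutes_with_d_zbar_def
    using commute_antilin_part_iff[OF diff] complex_0(1) by blast
  show "complex_haantjes A L"
    unfolding complex_haantjes_def
    using complex_haantjes_pointwise[OF diff] complex_0(2) by (simp add: coord_field_def)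
qed

end
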